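(* Let $C_n(x)$ be the minimal polynomial of $2\cos(\pi/n)$ and $\Theta_n(x)$ the minimal polynomial of $2\cos(2\pi/n)$. Then for $m\ge1$: $$\frac{P_m(x-2)}{\Theta_{2m+1}(x)}\ \begin{cases}=1&\text{if }2m+1\text{ is a prime number},\\ \in\mathbb{Z}[x]&\text{otherwise};\end{cases}$$ $$\frac{Q_m(x-2)}{C_{2m}(x)}\ \begin{cases}=1&\text{if }m\text{ is a power of }2,\\ =x&\text{if }m\text{ is an odd prime number},\\ \in\mathbb{Z}[x]&\text{otherwise};\end{cases}$$ $$\frac{-Q_{2m+1}(-x-2)}{x\,C_{4m+2}(x)}=\frac{(-1)^mP_m(-x^2)}{C_{4m+2}(x)}\ \begin{cases}=1&\text{if }2m+1\text{ is a prime number},\\ \in\mathbb{Z}[x]&\text{otherwise};\end{cases}$$ $$\frac{Q_{2m}(-x-2)}{C_{4m}(x)}=\frac{(-1)^mQ_m(-x^2)}{C_{4m}(x)}\ \begin{cases}=1&\text{if }m\text{ is a power of }2,\\ \in\mathbb{Z}[x]&\text{otherwise};\end{cases}$$ $$\frac{(-1)^mP_m(-x-2)}{C_{2m+1}(x)}=\frac{V_m(x)}{C_{2m+1}(x)}\ \begin{cases}=1&\text{if }2m+1\text{ is a prime number},\\ \in\mathbb{Z}[x]&\text{otherwise}.\end{cases}$$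
   Context: For an integer $m\ge1$: $P_m(x)=\sum_{k=0}^{m}\frac{2m+1}{2k+1}\binom{m+k}{2k}x^{k}$, $Q_m(x)=2+\sum_{k=1}^{m}\frac{m}{k}\binom{m+k-1}{2k-1}x^k$, and $V_m(x)=\sum_{k=0}^m(-1)^{m+\lfloor (m+k)/2\rfloor}\binom{\lfloor (m+k)/2\rfloor}{k}x^{k}$. The minimal polynomial of an algebraic number $\beta$ is the monic polynomial of least degree with rational coefficients having $\beta$ as a root. Powers of $2$ include $2^0=1$. *)

theory Defs
  imports Complex_Main "HOL-Computational_Algebra.Computational_Algebra"
begin

definition P_poly :: "nat \<Rightarrow> rat poly" where
  "P_poly m = (\<Sum>k=0..m. monom
     (of_nat (2 * m + 1) / of_nat (2 * k + 1) * of_nat ((m + k) choose (2 * k))) k)"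

definition Q_poly :: "nat \<Rightarrow> rat poly" where
  "Q_poly m = 2 + (\<Sum>k=1..m. monom
     (of_nat m / of_nat k * of_nat ((m + k - 1) choose (2 * k - 1))) k)"

definition V_poly :: "nat \<Rightarrow> rat poly" where
  "V_poly m = (\<Sum>k=0..m. monom
     ((-1) ^ (m + (m + k) div 2) * of_nat (((m + k) div 2) choose k)) k)"

definition is_min_poly :: "rat poly \<Rightarrow> 'a :: field_char_0 \<Rightarrow> bool" where
  "is_min_poly p \<beta> \<longleftrightarrow>
     lead_coeff p = 1 \<and> poly (map_poly of_rat p) \<beta> = 0 \<and>
     (\<forall>q. lead_coeff q = 1 \<and> poly (map_poly of_rat q) \<beta> = 0 \<longrightarrow> degree p \<le> degree q)"

definition min_poly :: "'a :: field_char_0 \<Rightarrow> rat poly" where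
  "min_poly \<beta> = (THE p. is_min_poly p \<beta>)"

definition C_poly :: "nat \<Rightarrow> rat poly" where
  "C_poly n = min_poly (2 * cos (pi / real n))"

definition Theta_poly :: "nat \<Rightarrow> rat poly" where
  "Theta_poly n = min_poly (2 * cos (2 * pi / real n))"

(* the ring Z[x], as a subset of the field Q(x) *)
definition int_polys :: "rat poly fract set" where
  "int_polys = range (\<lambda>r :: int poly. Fract (map_poly of_int r) 1)"

(* The next lemmas show that C_poly n and Theta_poly n are genuine minimal polynomials for
   n \<ge> 1.  In particular they are nonzero, so that the convention Fract a 0 = 0 is harmless
   for quotients with these denominators. *)

lemma map_poly_of_rat_smult:
  "map_poly of_rat (smult c p) = smult (of_rat c :: 'a :: field_char_0) (map_poly of_rat p)"
  by (rule poly_eqI) (simp add: coeff_map_poly of_rat_mult)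

lemma map_poly_of_rat_diff:
  "map_poly of_rat (p - q) = (map_poly of_rat p - map_poly of_rat q :: 'a :: field_char_0 poly)"
  by (rule poly_eqI) (simp add: coeff_map_poly of_rat_diff)

lemma is_min_poly_unique:
  fixes \<beta> :: "'a :: field_char_0"
  assumes p: "is_min_poly p \<beta>" and q: "is_min_poly q \<beta>"
  shows "p = q"
proof (rule ccontr)
  assume "p \<noteq> q"
  define r where "r = p - q"
  define s where "s = smult (inverse (lead_coeff r)) r"
  have "r \<noteq> 0" using \<open>p \<noteq> q\<close> by (simp add: r_def)
  have deg: "degree p = degree q"
    using p q unfolding is_min_poly_def by (metis le_antisym)
  have lc: "lead_coeff p = 1" "lead_coeff q = 1"
    using p q unfolding is_min_poly_def by auto
  have "lead_coeff s = 1" using \<open>r \<noteq> 0\<close> by (simp add: s_def)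
  moreover have "poly (map_poly of_rat s) \<beta> = 0"
    using p q unfolding is_min_poly_def s_def r_def
    by (simp add: map_poly_of_rat_smult map_poly_of_rat_diff)
  ultimately have "degree p \<le> degree s" using p unfolding is_min_poly_def by blast
  also have "degree s = degree r" using \<open>r \<noteq> 0\<close> by (simp add: s_def)
  finally have "degree p \<le> degree r" .
  moreover have "degree r \<le> degree p" unfolding r_def using deg by (simp add: degree_diff_le)
  ultimately have "degree r = degree p" by simp
  hence "lead_coeff r = 0" using lc deg by (simp add: r_def)
  with \<open>r \<noteq> 0\<close> show False by simp
qed

lemma is_min_poly_min_poly:
  fixes \<beta> :: "'a :: field_char_0"
  assumes "p \<noteq> 0" "poly (map_poly of_rat p) \<beta> = 0"
  shows "is_min_poly (min_poly \<beta>) \<beta>"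
proof -
  let ?R = "\<lambda>q. lead_coeff q = 1 \<and> poly (map_poly of_rat q) \<beta> = 0"
  have "?R (smult (inverse (lead_coeff p)) p)"
    using assms by (simp add: map_poly_of_rat_smult)
  then obtain q where q: "?R q" "\<And>q'. ?R q' \<Longrightarrow> degree q \<le> degree q'"
    using ex_has_least_nat[of ?R _ degree] by blast
  hence "is_min_poly q \<beta>" unfolding is_min_poly_def by blast
  thus ?thesis unfolding min_poly_def
    by (rule theI) (use \<open>is_min_poly q \<beta>\<close> is_min_poly_unique in blast)
qed

lemma two_cos_multiple:
  "\<exists>p :: rat poly. degree p = Suc n \<and> lead_coeff p = 1 \<and>
     (\<forall>t :: real. poly (map_poly of_rat p) (2 * cos t) = 2 * cos (real (Suc n) * t))"
proof (induction n rule: less_induct)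
  case (less n)
  consider "n = 0" | "n = 1" | k where "n = Suc (Suc k)"
    by (metis One_nat_def not0_implies_Suc)
  thus ?case
  proof cases
    case 1
    thus ?thesis by (intro exI[of _ "[:0, 1:]"]) (simp add: map_poly_pCons)
  next
    case 2
    have "poly (map_poly of_rat [:-2, 0, 1 :: rat:]) (2 * cos t) = 2 * cos (2 * t)" for t :: real
      by (simp add: map_poly_pCons cos_double_cos power2_eq_square of_rat_minus)
    with 2 show ?thesis by (intro exI[of _ "[:-2, 0, 1:]"]) simp
  next
    case 3
    from less[of "Suc k"] 3 obtain p where p: "degree p = Suc (Suc k)" "lead_coeff p = 1"
      "\<And>t :: real. poly (map_poly of_rat p) (2 * cos t) = 2 * cos (real (Suc (Suc k)) * t)"
      by auto
    from less[of k] 3 obtain q where q: "degree q = Suc k"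
      "\<And>t :: real. poly (map_poly of_rat q) (2 * cos t) = 2 * cos (real (Suc k) * t)"
      by auto
    let ?r = "pCons 0 p - q"
    have "p \<noteq> 0" using p by auto
    have deg: "degree (pCons 0 p) = Suc n" using p(1) \<open>p \<noteq> 0\<close> 3 by simp
    have "coeff ?r (Suc n) = 1" using p(1,2) q(1) 3 by (simp add: coeff_eq_0)
    moreover have "degree ?r \<le> Suc n" using deg q(1) 3 by (intro degree_diff_le) auto
    ultimately have "degree ?r = Suc n" by (metis le_antisym le_degree zero_neq_one)
    moreover have "poly (map_poly of_rat ?r) (2 * cos t) = 2 * cos (real (Suc n) * t)" for t :: real
    proof -
      define a where "a = real (Suc (Suc k)) * t"
      have "real (Suc n) * t = a + t" "real (Suc k) * t = a - t"
        using 3 by (simp_all add: a_def algebra_simps)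
      thus ?thesis
        using p(3)[of t, folded a_def] q(2)[of t]
        by (simp add: map_poly_of_rat_diff map_poly_pCons cos_add cos_diff)
    qed
    ultimately show ?thesis using \<open>coeff ?r (Suc n) = 1\<close> by (intro exI[of _ ?r]) simp
  qed
qed

lemma is_min_poly_two_cos:
  assumes "n \<ge> 1"
  shows "is_min_poly (min_poly (2 * cos (real j * pi / real n))) (2 * cos (real j * pi / real n))"
proof -
  obtain n' where n': "n = Suc n'" using assms by (cases n) auto
  obtain p :: "rat poly" where p: "degree p = Suc n'"
    "\<And>t :: real. poly (map_poly of_rat p) (2 * cos t) = 2 * cos (real n * t)"
    using two_cos_multiple[of n'] n' by metis
  let ?q = "p - [:2 * (-1) ^ j:]"
  have "?q \<noteq> 0" using p(1) by auto
  moreover have "poly (map_poly of_rat ?q) (2 * cos (real j * pi / real n)) = 0"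
    using assms by (simp add: map_poly_of_rat_diff p(2) map_poly_pCons of_rat_mult of_rat_power
        of_rat_minus)
  ultimately show ?thesis by (rule is_min_poly_min_poly)
qed

lemma is_min_poly_C_poly:
  "n \<ge> 1 \<Longrightarrow> is_min_poly (C_poly n) (2 * cos (pi / real n))"
  using is_min_poly_two_cos[of n 1] by (simp add: C_poly_def)

lemma is_min_poly_Theta_poly:
  "n \<ge> 1 \<Longrightarrow> is_min_poly (Theta_poly n) (2 * cos (2 * pi / real n))"
  using is_min_poly_two_cos[of n 2] by (simp add: Theta_poly_def)

end

theory Submission
  imports Defs
begin

text \<open>
  With \<open>x = y + 1/y\<close>, the polynomials \<open>T\<^sub>n(x) = y\<^sup>n + y\<^sup>-\<^sup>n\<close>,
  \<open>W\<^sub>m(x) = \<Sum>\<^sub>j y\<^sup>j\<close> for \<open>-m \<le> j \<le> m\<close>, and \<open>(-1)\<^sup>m W\<^sub>m(-x)\<close> all satisfy the recurrence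
  \<open>u(n+2) = x u(n+1) - u(n)\<close>.  Pascal's rule shows that the coefficients defining \<open>P\<^sub>m\<close>,
  \<open>Q\<^sub>m\<close> and \<open>V\<^sub>m\<close> obey the same kind of recurrence, so that
  \<open>Q\<^sub>m(x-2) = T\<^sub>m(x)\<close>, \<open>P\<^sub>m(x-2) = W\<^sub>m(x)\<close> and \<open>V\<^sub>m(x) = (-1)\<^sup>m W\<^sub>m(-x)\<close>.  Solutions
  of the recurrence are carried to solutions by ring homomorphisms, by multiplication with
  constants, by the factor \<open>(-1)\<^sup>n\<close>, which replaces \<open>x\<close> by \<open>-x\<close>, and by passing to every
  second term, which replaces \<open>x\<close> by \<open>x\<^sup>2 - 2\<close>; the equalities between the numerators are instances of these rules.  At
  \<open>x = 2 cos t\<close> these solutions are, up to constant factors, cosines at arithmetic progressions, and this shows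
  that each numerator vanishes at the number whose minimal polynomial is its denominator.

  All numerators are monic with integer coefficients.  A minimal polynomial divides every
  rational polynomial with the same root, and by Gauss's lemma
  (\<open>monic_factors_integral\<close>) the quotient of a monic integer polynomial by a monic rational
  divisor is again in \<open>\<int>[x]\<close>.  This gives integrality of all quotients.

  In the prime cases the numerator is irreducible, hence equal to the minimal polynomial.
  Irreducibility is best seen before the shift by \<open>2\<close>, where \<open>eisenstein\<close> applies: if
  \<open>p = 2m+1\<close> is prime, then \<open>(2k+1) a\<^sub>k = p (m+k choose 2k)\<close> makes \<open>p\<close> divide every
  coefficient \<open>a\<^sub>k\<close> of \<open>P\<^sub>m\<close> with \<open>k < m\<close>, and \<open>a\<^sub>0 = p\<close>; the same holds for
  \<open>(-1)\<^sup>m P\<^sub>m(-x\<^sup>2)\<close>.  If \<open>m\<close> is a power of \<open>2\<close>, then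
  \<open>k b\<^sub>k = m (m+k-1 choose 2k-1)\<close> makes every coefficient \<open>b\<^sub>k\<close> of \<open>Q\<^sub>m\<close> with
  \<open>0 < k < m\<close> even, and \<open>b\<^sub>0 = 2\<close>.  The remaining case, \<open>Q\<^sub>m(x-2)\<close> with \<open>m = 2n+1\<close> an odd
  prime, follows from \<open>T\<^sub>m(x) = x (-1)\<^sup>n P\<^sub>n(-x\<^sup>2)\<close>, whose second factor is irreducible.
\<close>

section \<open>Gauss's lemma\<close>

lemma map_poly_hom_add:
  assumes "h 0 = 0" "\<And>a b. h (a + b) = h a + h b"
  shows "map_poly h (p + q) = map_poly h p + map_poly h q"
  by (rule poly_eqI) (simp add: coeff_map_poly assms)

lemma map_poly_hom_mult:
  fixes h :: "'a::comm_semiring_0 \<Rightarrow> 'b::comm_semiring_0"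
  assumes "h 0 = 0" "\<And>a b. h (a + b) = h a + h b" "\<And>a b. h (a * b) = h a * h b"
  shows "map_poly h (p * q) = map_poly h p * map_poly h q"
proof (induction p)
  case (pCons c p)
  have smult: "map_poly h (smult c q) = smult (h c) (map_poly h q)"
    by (rule poly_eqI) (simp add: coeff_map_poly assms)
  show ?case
    using pCons by (simp add: map_poly_hom_add map_poly_pCons smult assms)
qed simp

lemma map_poly_hom_pcompose:
  fixes h :: "'a::comm_semiring_0 \<Rightarrow> 'b::comm_semiring_0"
  assumes "h 0 = 0" "\<And>a b. h (a + b) = h a + h b" "\<And>a b. h (a * b) = h a * h b"
  shows "map_poly h (pcompose p q) = pcompose (map_poly h p) (map_poly h q)"
  by (induction p)
     (simp_all add: pcompose_pCons map_poly_pCons map_poly_hom_add map_poly_hom_mult assms)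

abbreviation rat_poly_of_int :: "int poly \<Rightarrow> rat poly" where
  "rat_poly_of_int \<equiv> map_poly of_int"

abbreviation real_poly_of_rat :: "rat poly \<Rightarrow> real poly" where
  "real_poly_of_rat \<equiv> map_poly of_rat"

lemma rat_poly_of_int_mult: "rat_poly_of_int (p * q) = rat_poly_of_int p * rat_poly_of_int q"
  by (rule map_poly_hom_mult) auto

lemma rat_poly_of_int_eq_iff: "rat_poly_of_int p = rat_poly_of_int q \<longleftrightarrow> p = q"
  by (auto simp: poly_eq_iff coeff_map_poly)

lemma degree_rat_poly_of_int: "degree (rat_poly_of_int p) = degree p"
  by (rule degree_map_poly) auto

lemma lead_coeff_rat_poly_of_int: "lead_coeff (rat_poly_of_int p) = of_int (lead_coeff p)"
  by (simp add: degree_rat_poly_of_int coeff_map_poly)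

lemma rat_poly_of_int_smult: "rat_poly_of_int (smult c p) = smult (of_int c) (rat_poly_of_int p)"
  by (rule poly_eqI) (simp add: coeff_map_poly)

lemma clear_denominators:
  obtains N :: int and B where "N > 0" "smult (of_int N) A = rat_poly_of_int B"
proof -
  have "\<exists>N>0. \<exists>B. smult (of_int N) A = rat_poly_of_int B"
  proof (induction A)
    case 0
    show ?case by (intro exI[of _ 1] exI[of _ 0] conjI) auto
  next
    case (pCons c A)
    then obtain N B where NB: "N > 0" "smult (of_int N) A = rat_poly_of_int B" by blast
    obtain a b where ab: "quotient_of c = (a, b)" by force
    hence b: "b > 0" and c: "c = of_int a / of_int b"
      by (auto dest: quotient_of_denom_pos quotient_of_div)
    have "smult (of_int (b * N)) (pCons c A) = rat_poly_of_int (pCons (N * a) (smult b B))"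
      using b NB(2)[symmetric]
      by (simp add: c map_poly_pCons rat_poly_of_int_smult)
    with b NB(1) show ?case by (intro exI[of _ "b * N"]) auto
  qed
  thus ?thesis using that by blast
qed

text \<open>After clearing denominators, dividing by the content keeps the scaling factor an integer: since
  \<open>A\<close> is monic, this factor is the leading coefficient of the primitive part.\<close>

lemma primitive_multiple:
  fixes A :: "rat poly"
  assumes "lead_coeff A = 1"
  obtains a :: int and M where "a > 0" "content M = 1" "smult (of_int a) A = rat_poly_of_int M"
proof -
  obtain N B where NB: "N > 0" "smult (of_int N) A = rat_poly_of_int B"
    by (rule clear_denominators)
  define c where "c = content B"
  define M where "M = primitive_part B"
  have B: "B = smult c M" by (simp add: c_def M_def)
  have "A \<noteq> 0" using assms by auto
  hence "rat_poly_of_int B \<noteq> 0"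
    using NB by (metis of_int_0_eq_iff order_less_irrefl smult_eq_0_iff)
  hence "B \<noteq> 0" by auto
  hence M1: "content M = 1" by (simp add: M_def)
  have "c \<ge> 0" by (metis abs_ge_zero c_def normalize_content normalize_int_def)
  have "lead_coeff (smult (of_int N) A) = of_int (c * lead_coeff M)"
    unfolding NB(2) lead_coeff_rat_poly_of_int by (simp add: B)
  hence "of_int N = (of_int (c * lead_coeff M) :: rat)"
    using assms NB(1) by simp
  hence N: "N = c * lead_coeff M" by (simp only: of_int_eq_iff)
  hence "lead_coeff M > 0" "c \<noteq> 0" using NB(1) \<open>c \<ge> 0\<close> by (auto simp: zero_less_mult_iff)
  moreover have "smult (of_int c) (smult (of_int (lead_coeff M)) A)
      = smult (of_int c) (rat_poly_of_int M)"
    using NB(2) by (simp add: N B rat_poly_of_int_smult)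
  hence "smult (of_int (lead_coeff M)) A = rat_poly_of_int M"
    using \<open>c \<noteq> 0\<close> by (metis of_int_eq_0_iff smult_cancel)
  ultimately show ?thesis using that M1 by blast
qed

text \<open>Gauss's lemma in the form used below.  Scaling \<open>A\<close> and \<open>B\<close> by \<open>a\<close> and \<open>b\<close> to primitive
  polynomials makes \<open>ab F\<close> a product of primitive polynomials, hence primitive; but its content
  is \<open>ab\<close>, because the monic polynomial \<open>F\<close> is itself primitive.\<close>

lemma monic_factors_integral:
  assumes F: "lead_coeff F = 1" and AB: "rat_poly_of_int F = A * B" and A: "lead_coeff A = 1"
  obtains A' B' where "A = rat_poly_of_int A'" "B = rat_poly_of_int B'" "F = A' * B'"
proof -
  have "lead_coeff (A * B) = 1" using F by (simp add: AB[symmetric] lead_coeff_rat_poly_of_int)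
  hence B: "lead_coeff B = 1" using A by (simp add: lead_coeff_mult)
  obtain a M where M: "a > 0" "content M = 1" "smult (of_int a) A = rat_poly_of_int M"
    using primitive_multiple[OF A] .
  obtain b N where N: "b > 0" "content N = 1" "smult (of_int b) B = rat_poly_of_int N"
    using primitive_multiple[OF B] .
  have "rat_poly_of_int (smult (a * b) F) = rat_poly_of_int (M * N)"
    by (simp add: rat_poly_of_int_smult rat_poly_of_int_mult AB mult.commute flip: M(3) N(3))
  hence ab: "smult (a * b) F = M * N" by (simp only: rat_poly_of_int_eq_iff)
  have "content F dvd lead_coeff F" by (rule content_dvd_coeff)
  hence "content F = 1" using F by (metis is_unit_content_iff)
  hence "content (smult (a * b) F) = \<bar>a * b\<bar>" by (simp add: abs_mult)
  hence "a * b = 1" using M N by (simp add: ab content_mult)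
  hence "a = 1" "b = 1" using M(1) N(1) by (auto simp: zmult_eq_1_iff)
  thus ?thesis using that[of M N] M(3) N(3) ab by simp
qed

section \<open>The Eisenstein criterion\<close>

text \<open>In the sum for the coefficient of index \<open>i + j\<close>, every term other than
  \<open>coeff A i * coeff B j\<close> has an index below \<open>i\<close> in \<open>A\<close> or below \<open>j\<close> in \<open>B\<close>.\<close>

lemma not_dvd_coeff_mult:
  fixes A B :: "int poly"
  assumes p: "prime p" and i: "\<not> p dvd coeff A i" "\<And>k. k < i \<Longrightarrow> p dvd coeff A k"
    and j: "\<not> p dvd coeff B j" "\<And>k. k < j \<Longrightarrow> p dvd coeff B k"
  shows "\<not> p dvd coeff (A * B) (i + j)"
proof
  assume *: "p dvd coeff (A * B) (i + j)"
  have "p dvd (\<Sum>k\<in>{..i+j} - {i}. coeff A k * coeff B (i + j - k))"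
  proof (rule dvd_sum)
    fix k assume "k \<in> {..i+j} - {i}"
    hence "k < i \<or> i + j - k < j" by auto
    thus "p dvd coeff A k * coeff B (i + j - k)" using i(2) j(2) by fastforce
  qed
  moreover have "coeff (A * B) (i + j) =
      coeff A i * coeff B j + (\<Sum>k\<in>{..i+j} - {i}. coeff A k * coeff B (i + j - k))"
    unfolding coeff_mult by (subst sum.remove[of _ i]) auto
  ultimately have "p dvd coeff A i * coeff B j" using * by (simp add: dvd_add_left_iff)
  thus False using p i(1) j(1) prime_dvd_mult_iff by blast
qed

text \<open>In a nontrivial factorization, which by Gauss's lemma may be taken over \<open>\<int>\<close>, let \<open>i\<close> and \<open>j\<close>
  be the least indices of coefficients of the factors prime to \<open>p\<close>.  Then \<open>p\<close> does not divide
  the coefficient of index \<open>i + j\<close> of the product, so \<open>i + j\<close> is the full degree, and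
  \<open>i\<close> and \<open>j\<close> are the degrees of the factors.  As these are positive, both constant terms are divisible by \<open>p\<close>, and the constant term of the product by \<open>p\<^sup>2\<close>.\<close>

lemma eisenstein:
  fixes F :: "int poly"
  assumes F: "lead_coeff F = 1" "degree F > 0" and p: "prime p"
    and dvd: "\<And>k. k < degree F \<Longrightarrow> p dvd coeff F k" and sq: "\<not> p ^ 2 dvd coeff F 0"
  shows "irreducible (rat_poly_of_int F)"
proof (rule irreducibleI)
  show nz: "rat_poly_of_int F \<noteq> 0" using F by (auto simp: map_poly_eq_0_iff)
  show "\<not> rat_poly_of_int F dvd 1"
    using F(2) by (simp add: degree_rat_poly_of_int is_unit_iff_degree[OF nz])
next
  fix a b assume ab: "rat_poly_of_int F = a * b"
  show "a dvd 1 \<or> b dvd 1"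
  proof (rule ccontr)
    assume nu: "\<not> (a dvd 1 \<or> b dvd 1)"
    have "rat_poly_of_int F \<noteq> 0" using F by (auto simp: map_poly_eq_0_iff)
    hence nz: "a \<noteq> 0" "b \<noteq> 0" using ab by auto
    with nu have deg: "degree a > 0" "degree b > 0" by (auto simp: is_unit_iff_degree)
    \<comment> \<open>Moving the leading coefficient to the other factor makes one factor monic.\<close>
    define c where "c = lead_coeff a"
    have "c \<noteq> 0" using nz by (simp add: c_def)
    have "rat_poly_of_int F = smult (inverse c) a * smult c b" using \<open>c \<noteq> 0\<close> by (simp add: ab)
    moreover have "lead_coeff (smult (inverse c) a) = 1" using \<open>c \<noteq> 0\<close> by (simp add: c_def)
    ultimately obtain A B where A: "smult (inverse c) a = rat_poly_of_int A"
      and B: "smult c b = rat_poly_of_int B" and AB: "F = A * B"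
      using monic_factors_integral[OF F(1)] by blast
    have "degree A > 0" "degree B > 0"
      using arg_cong[OF A, of degree] arg_cong[OF B, of degree] deg \<open>c \<noteq> 0\<close>
      by (auto simp: degree_rat_poly_of_int)
    have "lead_coeff A * lead_coeff B = 1" using F(1) by (simp add: AB lead_coeff_mult)
    hence "is_unit (lead_coeff A)" "is_unit (lead_coeff B)" by (metis dvd_triv_left dvd_triv_right)+
    hence lc: "\<not> p dvd lead_coeff A" "\<not> p dvd lead_coeff B"
      using p by (meson dvd_trans not_prime_unit)+
    define i where "i = (LEAST k. \<not> p dvd coeff A k)"
    define j where "j = (LEAST k. \<not> p dvd coeff B k)"
    have i: "\<not> p dvd coeff A i" "\<And>k. k < i \<Longrightarrow> p dvd coeff A k" "i \<le> degree A"
      using LeastI[of "\<lambda>k. \<not> p dvd coeff A k", OF lc(1)]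
        not_less_Least[of _ "\<lambda>k. \<not> p dvd coeff A k"]
        Least_le[of "\<lambda>k. \<not> p dvd coeff A k", OF lc(1)] unfolding i_def by blast+
    have j: "\<not> p dvd coeff B j" "\<And>k. k < j \<Longrightarrow> p dvd coeff B k" "j \<le> degree B"
      using LeastI[of "\<lambda>k. \<not> p dvd coeff B k", OF lc(2)]
        not_less_Least[of _ "\<lambda>k. \<not> p dvd coeff B k"]
        Least_le[of "\<lambda>k. \<not> p dvd coeff B k", OF lc(2)] unfolding j_def by blast+
    have "\<not> p dvd coeff F (i + j)"
      unfolding AB using not_dvd_coeff_mult[OF p i(1,2) j(1,2)] .
    hence "i + j \<ge> degree F" using dvd not_le by blast
    moreover have "degree F = degree A + degree B"
      using \<open>degree A > 0\<close> \<open>degree B > 0\<close> unfolding AB by (intro degree_mult_eq) auto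
    ultimately have "i > 0" "j > 0" using i(3) j(3) \<open>degree A > 0\<close> \<open>degree B > 0\<close> by auto
    hence "p * p dvd coeff A 0 * coeff B 0" using i(2) j(2) by (intro mult_dvd_mono) auto
    thus False using sq by (simp add: AB coeff_mult_0 power2_eq_square)
  qed
qed

text \<open>Composition with an invertible affine map is undone by composing with its inverse, which turns
  factorizations into factorizations of the same degrees.\<close>

lemma irreducible_pcompose_linear:
  fixes f :: "'a::field poly"
  assumes f: "irreducible f" and c: "c \<noteq> 0"
  shows "irreducible (pcompose f [:b, c:])"
proof -
  define l where "l = [:- b / c, 1 / c:]"
  have inv: "pcompose [:b, c:] l = [:0, 1:]" using c by (simp add: l_def pcompose_pCons)
  have deg: "degree (pcompose q [:b, c:]) = degree q" "degree (pcompose q l) = degree q"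
    for q :: "'a poly" using c by (simp_all add: degree_pcompose l_def)
  have "f \<noteq> 0" "degree f > 0" using f by (auto simp: irreducible_def is_unit_iff_degree)
  show ?thesis
  proof (rule irreducibleI)
    show nz: "pcompose f [:b, c:] \<noteq> 0" using \<open>degree f > 0\<close> deg(1)[of f] by auto
    show "\<not> pcompose f [:b, c:] dvd 1"
      using \<open>degree f > 0\<close> deg(1)[of f] is_unit_iff_degree[OF nz] by simp
  next
    fix u v assume uv: "pcompose f [:b, c:] = u * v"
    have "f = pcompose (pcompose f [:b, c:]) l" by (simp add: inv flip: pcompose_assoc)
    also have "\<dots> = pcompose u l * pcompose v l" by (simp add: uv pcompose_mult)
    finally have *: "f = pcompose u l * pcompose v l" .
    hence "pcompose u l dvd 1 \<or> pcompose v l dvd 1" using f irreducibleD by blast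
    moreover have "pcompose u l \<noteq> 0" "pcompose v l \<noteq> 0" using * \<open>f \<noteq> 0\<close> by auto
    moreover from this have "u \<noteq> 0" "v \<noteq> 0" by auto
    ultimately show "u dvd 1 \<or> v dvd 1" by (simp add: is_unit_iff_degree deg)
  qed
qed

section \<open>Quotients by minimal polynomials\<close>

lemma real_poly_of_rat_mult: "real_poly_of_rat (p * q) = real_poly_of_rat p * real_poly_of_rat q"
  by (rule map_poly_hom_mult) (auto simp: of_rat_add of_rat_mult)

lemma min_poly_dvd:
  fixes \<beta> :: real
  assumes p: "is_min_poly p \<beta>" and q: "poly (real_poly_of_rat q) \<beta> = 0"
  shows "p dvd q"
proof (rule ccontr)
  define r where "r = q mod p"
  assume "\<not> p dvd q"
  hence "r \<noteq> 0" by (auto simp: r_def dvd_eq_mod_eq_0)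
  have "p \<noteq> 0" using p by (auto simp: is_min_poly_def)
  have "r = q - p * (q div p)" by (simp add: r_def minus_mult_div_eq_mod)
  hence "poly (real_poly_of_rat r) \<beta> = 0"
    using p q by (simp add: map_poly_of_rat_diff real_poly_of_rat_mult is_min_poly_def)
  hence "poly (real_poly_of_rat (smult (inverse (lead_coeff r)) r)) \<beta> = 0"
    by (simp add: map_poly_of_rat_smult)
  moreover have "lead_coeff (smult (inverse (lead_coeff r)) r) = 1" using \<open>r \<noteq> 0\<close> by simp
  ultimately have "degree p \<le> degree (smult (inverse (lead_coeff r)) r)"
    using p unfolding is_min_poly_def by blast
  also have "\<dots> = degree r" using \<open>r \<noteq> 0\<close> by simp
  also have "degree r < degree p"
    using degree_mod_less[OF \<open>p \<noteq> 0\<close>, of q] \<open>r \<noteq> 0\<close> by (auto simp: r_def)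
  finally show False by simp
qed

lemma min_poly_eq_irreducible:
  fixes \<beta> :: real
  assumes f: "irreducible f" "lead_coeff f = 1" "poly (real_poly_of_rat f) \<beta> = 0"
  shows "min_poly \<beta> = f"
proof -
  let ?p = "min_poly \<beta>"
  have p: "is_min_poly ?p \<beta>" using f by (intro is_min_poly_min_poly[of f]) auto
  then obtain r where r: "f = ?p * r" using min_poly_dvd[OF p f(3)] by (auto elim: dvdE)
  have "\<not> ?p dvd 1"
  proof
    assume "?p dvd 1"
    then obtain c where "?p = [:c:]" by (auto simp: is_unit_poly_iff)
    moreover have "?p \<noteq> 0" using p by (auto simp: is_min_poly_def)
    ultimately show False using p by (simp add: is_min_poly_def map_poly_pCons)
  qed
  hence "r dvd 1" using irreducibleD[OF f(1) r] by blast
  then obtain c where c: "r = [:c:]" by (auto simp: is_unit_poly_iff)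
  have "lead_coeff ?p = 1" using p by (simp add: is_min_poly_def)
  moreover have "lead_coeff f = lead_coeff ?p * c"
    by (simp add: r c lead_coeff_mult del: mult_pCons_right)
  ultimately have "c = 1" using f(2) by simp
  thus ?thesis using r c by (simp add: one_pCons[symmetric])
qed

lemma Fract_self_min_poly:
  fixes \<beta> :: real
  assumes "irreducible f" "lead_coeff f = 1" "poly (real_poly_of_rat f) \<beta> = 0"
  shows "Fract f (min_poly \<beta>) = 1"
proof -
  have "f \<noteq> 0" using assms by auto
  thus ?thesis by (simp add: min_poly_eq_irreducible[OF assms] One_fract_def eq_fract)
qed

text \<open>The divisibility in \<open>\<rat>[x]\<close> becomes one in \<open>\<int>[x]\<close> by Gauss's lemma, as both the numerator
  and the minimal polynomial are monic.\<close>

lemma Fract_min_poly_in_int_polys: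
  fixes \<beta> :: real
  assumes F: "lead_coeff F = 1" "poly (real_poly_of_rat (rat_poly_of_int F)) \<beta> = 0"
  shows "Fract (rat_poly_of_int F) (min_poly \<beta>) \<in> int_polys"
proof -
  let ?p = "min_poly \<beta>"
  have "rat_poly_of_int F \<noteq> 0" using F(1) by (auto simp: map_poly_eq_0_iff)
  hence p: "is_min_poly ?p \<beta>" using F(2) by (rule is_min_poly_min_poly)
  hence p1: "lead_coeff ?p = 1" by (simp add: is_min_poly_def)
  obtain r where r: "rat_poly_of_int F = ?p * r" using min_poly_dvd[OF p F(2)] by (auto elim: dvdE)
  obtain R where "r = rat_poly_of_int R" using monic_factors_integral[OF F(1) r p1] by metis
  moreover have "?p \<noteq> 0" using p1 by auto
  hence "Fract (?p * r) ?p = Fract r 1" by (simp add: eq_fract)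
  ultimately show ?thesis unfolding r int_polys_def by auto
qed


section \<open>Second-order recurrences\<close>

text \<open>The initial values are kept arbitrary and the ring general, so that one set of transformation
  rules serves rational polynomials, integer polynomials and real numbers alike.\<close>

fun lucas :: "'a::comm_ring_1 \<Rightarrow> 'a \<Rightarrow> 'a \<Rightarrow> nat \<Rightarrow> 'a" where
  "lucas x a b 0 = a"
| "lucas x a b (Suc 0) = b"
| "lucas x a b (Suc (Suc n)) = x * lucas x a b (Suc n) - lucas x a b n"

lemma lucas_unique:
  assumes "\<And>n. g (Suc (Suc n)) = x * g (Suc n) - g n"
  shows "lucas x (g 0) (g (Suc 0)) n = g n"
  by (induction n rule: induct_nat_012) (simp_all add: assms)

lemma lucas_hom:
  assumes "\<And>u v. h (u * v) = h u * h v" "\<And>u v. h (u - v) = h u - h v"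
  shows "h (lucas x a b n) = lucas (h x) (h a) (h b) n"
  by (induction n rule: induct_nat_012) (simp_all add: assms)

lemma lucas_mult: "c * lucas x a b n = lucas x (c * a) (c * b) n"
  by (induction n rule: induct_nat_012) (simp_all add: right_diff_distrib mult.left_commute[of c x])

lemma lucas_uminus: "(-1) ^ n * lucas x a b n = lucas (-x) a (-b) n"
proof (induction n rule: induct_nat_012)
  case (ge2 n)
  show ?case unfolding lucas.simps ge2[symmetric] by (simp add: algebra_simps)
qed simp_all

text \<open>A solution with characteristic roots \<open>y\<close> and \<open>1/y\<close> has, at every second index, characteristic
  roots \<open>y\<^sup>2\<close> and \<open>1/y\<^sup>2\<close>, whose sum is \<open>x\<^sup>2 - 2\<close>.\<close>

lemma lucas_even: "lucas x a b (2 * n) = lucas (x^2 - 2) a (x * b - a) n"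
proof -
  define g where "g = (\<lambda>n. lucas x a b (2 * n))"
  have "g (Suc (Suc n)) = (x^2 - 2) * g (Suc n) - g n" for n
  proof -
    have "2 * Suc n = Suc (Suc (2 * n))" "2 * Suc (Suc n) = Suc (Suc (Suc (Suc (2 * n))))" by simp_all
    thus ?thesis
      unfolding g_def by (simp only: lucas.simps Suc_eq_plus1[symmetric])
        (simp add: algebra_simps power2_eq_square)
  qed
  from lucas_unique[of g, OF this, of n]
  show ?thesis by (simp add: g_def eval_nat_numeral)
qed

lemma lucas_odd: "lucas x a b (2 * n + 1) = lucas (x^2 - 2) b (x * (x * b - a) - b) n"
proof -
  define g where "g = (\<lambda>n. lucas x a b (2 * n + 1))"
  have "g (Suc (Suc n)) = (x^2 - 2) * g (Suc n) - g n" for n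
  proof -
    have "2 * Suc n = Suc (Suc (2 * n))" "2 * Suc (Suc n) = Suc (Suc (Suc (Suc (2 * n))))" by simp_all
    thus ?thesis
      unfolding g_def by (simp only: lucas.simps Suc_eq_plus1[symmetric])
        (simp add: algebra_simps power2_eq_square)
  qed
  from lucas_unique[of g, OF this, of n]
  show ?thesis by (simp add: g_def eval_nat_numeral)
qed

text \<open>The addition theorem in the form \<open>cos (u + t) + cos (u - t) = 2 cos t cos u\<close> is the recurrence.\<close>

lemma lucas_cos:
  fixes t s :: real
  shows "lucas (2 * cos t) (cos s) (cos (t + s)) n = cos (real n * t + s)"
proof -
  have "cos (real (Suc (Suc n)) * t + s) =
      2 * cos t * cos (real (Suc n) * t + s) - cos (real n * t + s)" for n
  proof -
    define u where "u = real (Suc n) * t + s"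
    have "real (Suc (Suc n)) * t + s = u + t" "real n * t + s = u - t"
      by (simp_all add: u_def algebra_simps)
    thus ?thesis unfolding u_def[symmetric] by (simp add: cos_add cos_diff)
  qed
  from lucas_unique[of "\<lambda>n. cos (real n * t + s)" "2 * cos t" n, OF this] show ?thesis by simp
qed

section \<open>Coefficients of the three families\<close>

text \<open>Integer versions of the first two families.  Starting from the recurrence makes integrality
  evident; agreement with the given formulas is checked on coefficients.\<close>

abbreviation P_int :: "nat \<Rightarrow> int poly" where "P_int \<equiv> lucas [:2, 1:] 1 [:3, 1:]"
abbreviation Q_int :: "nat \<Rightarrow> int poly" where "Q_int \<equiv> lucas [:2, 1:] 2 [:2, 1:]"

lemma coeff_two_plus_X_mult:
  fixes p :: "int poly"
  shows
  "coeff ([:2, 1:] * p) k = 2 * coeff p k + (case k of 0 \<Rightarrow> 0 | Suc j \<Rightarrow> coeff p j)"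
  by (cases k) simp_all

text \<open>Writing \<open>(2m+1)/(2k+1)\<close> as \<open>1 + 2(m-k)/(2k+1)\<close> turns the given coefficient into a sum of
  binomial coefficients, which satisfies the recurrence by Pascal's rule and vanishes for
  \<open>k > m\<close> by itself.\<close>

lemma coeff_P_int: "coeff (P_int m) k = int ((m + k choose (2 * k)) + 2 * (m + k choose Suc (2 * k)))"
proof (induction m arbitrary: k rule: induct_nat_012)
  case 0
  show ?case by (cases k) (simp_all add: coeff_1 binomial_eq_0)
next
  case 1
  consider "k = 0" | "k = 1" | j where "k = Suc (Suc j)" by (metis One_nat_def not0_implies_Suc)
  thus ?case by cases (simp_all add: binomial_eq_0 numeral_2_eq_2)
next
  case (ge2 m)
  show ?case
    by (cases k) (simp_all only: lucas.simps coeff_diff coeff_two_plus_X_mult ge2,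
        simp_all add: algebra_simps)
qed

lemma coeff_Q_int: "coeff (Q_int m) k = int ((m + k choose (2 * k)) + (m + k - 1 choose (2 * k)))"
proof (induction m arbitrary: k rule: induct_nat_012)
  case 0
  show ?case by (cases k) (simp_all add: binomial_eq_0 numeral_poly)
next
  case 1
  consider "k = 0" | "k = 1" | j where "k = Suc (Suc j)" by (metis One_nat_def not0_implies_Suc)
  thus ?case by cases (simp_all add: binomial_eq_0 numeral_2_eq_2)
next
  case (ge2 m)
  show ?case
    by (cases k) (simp_all only: lucas.simps coeff_diff coeff_two_plus_X_mult ge2,
        simp_all add: algebra_simps)
qed

lemma Suc_times_binomial_Suc: "Suc k * (n choose Suc k) = (n - k) * (n choose k)"
  by (simp only: binomial_absorption binomial_absorb_comp)

text \<open>The given formula for the coefficients with the denominator cleared.  This form is also the one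
  that yields divisibility by \<open>2m+1\<close>.\<close>

lemma coeff_P_int_mult: "int (2 * k + 1) * coeff (P_int m) k = int (2 * m + 1) * int (m + k choose (2 * k))"
proof (cases "k \<le> m")
  case True
  have "Suc (2 * k) * (m + k choose Suc (2 * k)) = (m - k) * (m + k choose (2 * k))"
    using True by (simp only: Suc_times_binomial_Suc) simp
  hence "int (Suc (2 * k) * (m + k choose Suc (2 * k))) = (int m - int k) * int (m + k choose (2 * k))"
    using True by (simp add: of_nat_diff)
  thus ?thesis unfolding coeff_P_int by (simp add: algebra_simps)
qed (simp add: coeff_P_int binomial_eq_0)

lemma coeff_Q_int_mult:
  assumes "k \<ge> 1" "m \<ge> 1"
  shows "int k * coeff (Q_int m) k = int m * int (m + k - 1 choose (2 * k - 1))"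
proof (cases "k \<le> m")
  case True
  obtain j where j: "k = Suc j" using assms by (cases k) auto
  define n where "n = m + k - 1"
  have n: "m + k = Suc n" "2 * k = Suc (Suc (2 * j))" using assms by (auto simp: n_def j)
  have "Suc (Suc (2 * j)) * (n choose Suc (Suc (2 * j))) = (n - Suc (2 * j)) * (n choose Suc (2 * j))"
    by (rule Suc_times_binomial_Suc)
  also have "n - Suc (2 * j) = m - k" by (simp add: n_def j)
  finally have "2 * k * (n choose (2 * k)) = (m - k) * (n choose (2 * k - 1))" by (simp only: n(2)) simp
  hence "int (2 * k * (n choose (2 * k))) = int ((m - k) * (n choose (2 * k - 1)))" by (simp only:)
  hence "int (2 * k) * int (n choose (2 * k)) = (int m - int k) * int (n choose (2 * k - 1))"
    using True by (simp add: of_nat_diff)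
  moreover have "(m + k choose (2 * k)) = (n choose (2 * k - 1)) + (n choose (2 * k))"
    by (simp add: n)
  ultimately show ?thesis unfolding coeff_Q_int n_def[symmetric] by (simp add: algebra_simps)
qed (use assms in \<open>simp add: coeff_Q_int binomial_eq_0\<close>)

lemma of_int_fract_eq:
  assumes "int b * c = int a * int d" "b > 0"
  shows "of_nat a / of_nat b * of_nat d = (of_int c :: rat)"
proof -
  have "of_nat b * of_int c = (of_nat a * of_nat d :: rat)"
    using arg_cong[OF assms(1), of "of_int :: int \<Rightarrow> rat"] by simp
  thus ?thesis using assms(2) by (simp add: field_simps)
qed

lemma P_poly_eq_int: "P_poly m = rat_poly_of_int (P_int m)"
proof (rule poly_eqI)
  fix k
  have "coeff (P_poly m) k = (if k \<le> m then
      of_nat (2 * m + 1) / of_nat (2 * k + 1) * of_nat ((m + k) choose (2 * k)) else 0)"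
    unfolding P_poly_def by (simp add: coeff_sum coeff_monom if_distrib sum.If_cases cong: if_cong)
  also have "\<dots> = of_int (coeff (P_int m) k)"
  proof (cases "k \<le> m")
    case True
    have "of_nat (2 * m + 1) / of_nat (2 * k + 1) * of_nat ((m + k) choose (2 * k)) =
        (of_int (coeff (P_int m) k) :: rat)"
      using coeff_P_int_mult[of k m] by (intro of_int_fract_eq) auto
    with True show ?thesis by (simp only: if_True)
  qed (simp add: coeff_P_int binomial_eq_0)
  finally show "coeff (P_poly m) k = coeff (rat_poly_of_int (P_int m)) k" by (simp add: coeff_map_poly)
qed

lemma Q_poly_eq_int: "m \<ge> 1 \<Longrightarrow> Q_poly m = rat_poly_of_int (Q_int m)"
proof (rule poly_eqI)
  fix k assume m: "m \<ge> 1"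
  have "coeff (Q_poly m) k = (if k = 0 then 2 else if k \<le> m then
      of_nat m / of_nat k * of_nat ((m + k - 1) choose (2 * k - 1)) else 0)"
    unfolding Q_poly_def by (cases k)
     (simp_all add: coeff_sum coeff_monom numeral_poly if_distrib sum.If_cases coeff_pCons cong: if_cong)
  also have "\<dots> = of_int (coeff (Q_int m) k)"
  proof (cases "k \<ge> 1 \<and> k \<le> m")
    case True
    hence "of_nat m / of_nat k * of_nat ((m + k - 1) choose (2 * k - 1)) =
        (of_int (coeff (Q_int m) k) :: rat)"
      using coeff_Q_int_mult[of k m] m by (intro of_int_fract_eq) auto
    with True show ?thesis by simp
  qed (auto simp: coeff_Q_int binomial_eq_0)
  finally show "coeff (Q_poly m) k = coeff (rat_poly_of_int (Q_int m)) k" by (simp add: coeff_map_poly)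
qed

lemma coeff_V_lucas:
  "coeff (lucas [:0, 1:] 1 [:-1, 1:] m :: rat poly) k =
     (-1) ^ (m + (m + k) div 2) * of_nat (((m + k) div 2) choose k)"
proof (induction m arbitrary: k rule: induct_nat_012)
  case 0
  show ?case by (cases k) (simp_all add: coeff_1 binomial_eq_0)
next
  case 1
  consider "k = 0" | "k = 1" | j where "k = Suc (Suc j)" by (metis One_nat_def not0_implies_Suc)
  thus ?case by cases (simp_all add: binomial_eq_0)
next
  case (ge2 m)
  show ?case
  proof (cases k)
    case (Suc j)
    have "Suc (Suc m) + k = Suc (Suc (m + k))" "Suc m + j = m + k" by (simp_all add: Suc)
    thus ?thesis
      using ge2(1)[of k] ge2(2)[of j] by (simp add: Suc algebra_simps)
  qed (use ge2(1)[of 0] in simp)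
qed

lemma V_poly_eq_lucas: "V_poly m = lucas [:0, 1:] 1 [:-1, 1:] m"
proof (rule poly_eqI)
  fix k
  have "coeff (V_poly m) k = (if k \<le> m then
      (-1) ^ (m + (m + k) div 2) * of_nat (((m + k) div 2) choose k) else 0)"
    unfolding V_poly_def by (simp add: coeff_sum coeff_monom if_distrib sum.If_cases cong: if_cong)
  also have "\<dots> = (-1) ^ (m + (m + k) div 2) * of_nat (((m + k) div 2) choose k)"
    by (auto simp: binomial_eq_0)
  finally show "coeff (V_poly m) k = coeff (lucas [:0, 1:] 1 [:-1, 1:] m) k"
    by (simp add: coeff_V_lucas)
qed

lemma P_poly_eq_lucas: "P_poly m = lucas [:2, 1:] 1 [:3, 1:] m"
  unfolding P_poly_eq_int
  by (subst lucas_hom[where h = rat_poly_of_int])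
     (simp_all add: rat_poly_of_int_mult poly_eq_iff coeff_map_poly map_poly_pCons)

lemma Q_poly_eq_lucas: "m \<ge> 1 \<Longrightarrow> Q_poly m = lucas [:2, 1:] 2 [:2, 1:] m"
  unfolding Q_poly_eq_int
  by (subst lucas_hom[where h = rat_poly_of_int])
     (simp_all add: rat_poly_of_int_mult poly_eq_iff coeff_map_poly map_poly_pCons numeral_poly)

section \<open>Identities between the numerators\<close>

lemma pcompose_lucas: "pcompose (lucas x a b n) q = lucas (pcompose x q) (pcompose a q) (pcompose b q) n"
  by (rule lucas_hom) (simp_all add: pcompose_mult pcompose_diff)

lemma P_poly_shift: "pcompose (P_poly m) [:-2, 1:] = lucas [:0, 1:] 1 [:1, 1:] m"
  by (simp add: P_poly_eq_lucas pcompose_lucas pcompose_pCons pcompose_1)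

lemma Q_poly_shift:
  "m \<ge> 1 \<Longrightarrow> pcompose (Q_poly m) [:-2, 1:] = lucas [:0, 1:] 2 [:0, 1:] m"
  by (simp add: Q_poly_eq_lucas pcompose_lucas pcompose_pCons numeral_poly)

lemma P_poly_reflect: "(-1) ^ m * pcompose (P_poly m) [:-2, -1:] = V_poly m"
  by (simp add: P_poly_eq_lucas V_poly_eq_lucas pcompose_lucas pcompose_pCons pcompose_1 lucas_uminus)

lemma Q_poly_reflect:
  "m \<ge> 1 \<Longrightarrow> (-1) ^ m * pcompose (Q_poly m) [:-2, -1:] = lucas [:0, 1:] 2 [:0, 1:] m"
  by (simp add: Q_poly_eq_lucas pcompose_lucas pcompose_pCons numeral_poly lucas_uminus)

text \<open>On the right stands every second term of a sequence, so the recurrence has parameter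
  \<open>x\<^sup>2 - 2\<close>; on the left the parameter \<open>x + 2\<close> of \<open>P\<close> becomes \<open>2 - x\<^sup>2\<close>, and the sign
  \<open>(-1)\<^sup>m\<close> changes it to \<open>x\<^sup>2 - 2\<close>.\<close>

lemma P_poly_neg_square:
  "[:0, 1:] * ((-1) ^ m * pcompose (P_poly m) [:0, 0, -1:]) = lucas [:0, 1:] 2 [:0, 1:] (2 * m + 1)"
  unfolding lucas_odd P_poly_eq_lucas pcompose_lucas lucas_uminus unfolding lucas_mult
  by (simp add: pcompose_pCons pcompose_1 numeral_poly power2_eq_square)

lemma Q_poly_neg_square:
  "m \<ge> 1 \<Longrightarrow> (-1) ^ m * pcompose (Q_poly m) [:0, 0, -1:] = lucas [:0, 1:] 2 [:0, 1:] (2 * m)"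
  unfolding lucas_even
  by (simp add: Q_poly_eq_lucas pcompose_lucas pcompose_pCons lucas_uminus
      numeral_poly power2_eq_square)

section \<open>Values at twice a cosine\<close>

lemma eval_lucas:
  "poly (real_poly_of_rat (lucas x a b n)) \<beta> =
     lucas (poly (real_poly_of_rat x) \<beta>) (poly (real_poly_of_rat a) \<beta>) (poly (real_poly_of_rat b) \<beta>) n"
  by (rule lucas_hom[where h = "\<lambda>q. poly (real_poly_of_rat q) \<beta>"])
     (simp_all add: real_poly_of_rat_mult map_poly_of_rat_diff)

lemma eval_T: "poly (real_poly_of_rat (lucas [:0, 1:] 2 [:0, 1:] n)) (2 * cos t) = 2 * cos (real n * t)"
  using lucas_cos[of t 0 n] lucas_mult[of 2 "2 * cos t" 1 "cos t" n]
  by (simp add: eval_lucas map_poly_pCons numeral_poly)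

text \<open>The sine is written as a cosine with phase \<open>t/2 - \<pi>/2\<close> to fit the cosine solution of the
  recurrence.  The factor \<open>sin (t / 2)\<close> takes the place of a division that would fail where it
  vanishes.\<close>

lemma eval_W:
  "sin (t / 2) * poly (real_poly_of_rat (lucas [:0, 1:] 1 [:1, 1:] n)) (2 * cos t)
     = sin (real (2 * n + 1) * t / 2)"
proof -
  define s where "s = t / 2 - pi / 2"
  have "sin (t / 2) = cos s" by (simp add: s_def cos_diff)
  moreover have "sin (t / 2) * (1 + 2 * cos t) = cos (t + s)"
  proof -
    have "2 * cos t * sin (t / 2) = sin (t + t / 2) - sin (t - t / 2)"
      by (simp only: sin_add sin_diff)
    moreover have "t + s = (t + t / 2) - pi / 2" by (simp add: s_def)
    hence "cos (t + s) = sin (t + t / 2)" by (simp only: cos_diff) simp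
    ultimately show ?thesis by (simp add: algebra_simps)
  qed
  moreover have "cos (real n * t + s) = sin (real (2 * n + 1) * t / 2)"
  proof -
    have "real n * t + s = real (2 * n + 1) * t / 2 - pi / 2" by (simp add: s_def field_simps)
    thus ?thesis by (simp only: cos_diff) simp
  qed
  ultimately show ?thesis
    using lucas_cos[of t s n] by (simp add: eval_lucas map_poly_pCons lucas_mult)
qed

lemma eval_V:
  "cos (t / 2) * poly (real_poly_of_rat (lucas [:0, 1:] 1 [:-1, 1:] n)) (2 * cos t)
     = cos (real (2 * n + 1) * t / 2)"
proof -
  have "cos (t / 2) * (2 * cos t - 1) = cos (t + t / 2)"
  proof -
    have "2 * cos t * cos (t / 2) = cos (t + t / 2) + cos (t - t / 2)"
      by (simp only: cos_add cos_diff)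
    thus ?thesis by (simp add: algebra_simps)
  qed
  moreover have "cos (real n * t + t / 2) = cos (real (2 * n + 1) * t / 2)"
    by (rule arg_cong[of _ _ cos]) (simp add: field_simps)
  ultimately show ?thesis
    using lucas_cos[of t "t / 2" n]
    by (simp only: eval_lucas lucas_mult) (simp add: map_poly_pCons of_rat_minus)
qed


lemma root_T:
  assumes "n \<ge> 1"
  shows "poly (real_poly_of_rat (lucas [:0, 1:] 2 [:0, 1:] n)) (2 * cos (pi / real (2 * n))) = 0"
proof -
  have "real n * (pi / real (2 * n)) = pi / 2" using assms by (simp add: field_simps)
  thus ?thesis by (simp only: eval_T) simp
qed

lemma root_W:
  assumes "m \<ge> 1"
  shows "poly (real_poly_of_rat (lucas [:0, 1:] 1 [:1, 1:] m)) (2 * cos (2 * pi / real (2 * m + 1))) = 0"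
proof -
  define t where "t = 2 * pi / real (2 * m + 1)"
  have "real (2 * m + 1) * t / 2 = pi" by (simp add: t_def del: of_nat_add of_nat_mult of_nat_Suc)
  hence "sin (t / 2) * poly (real_poly_of_rat (lucas [:0, 1:] 1 [:1, 1:] m)) (2 * cos t) = 0"
    by (simp only: eval_W) simp
  moreover have "sin (t / 2) > 0"
    using assms by (intro sin_gt_zero) (auto simp: t_def field_simps)
  ultimately show ?thesis by (simp add: t_def)
qed

lemma root_V:
  assumes "m \<ge> 1"
  shows "poly (real_poly_of_rat (V_poly m)) (2 * cos (pi / real (2 * m + 1))) = 0"
proof -
  define t where "t = pi / real (2 * m + 1)"
  have "real (2 * m + 1) * t / 2 = pi / 2" by (simp add: t_def del: of_nat_add of_nat_mult of_nat_Suc)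
  hence "cos (t / 2) * poly (real_poly_of_rat (V_poly m)) (2 * cos t) = 0"
    unfolding V_poly_eq_lucas by (simp only: eval_V) simp
  moreover have "t > 0" "t < pi" using assms by (auto simp: t_def field_simps)
  hence "cos (t / 2) > 0" by (intro cos_gt_zero_pi) auto
  ultimately show ?thesis by (simp add: t_def)
qed

lemma root_P_neg_square:
  assumes "m \<ge> 1"
  shows "poly (real_poly_of_rat ((-1) ^ m * pcompose (P_poly m) [:0, 0, -1:]))
           (2 * cos (pi / real (4 * m + 2))) = 0"
proof -
  define t where "t = pi / real (2 * (2 * m + 1))"
  have "poly (real_poly_of_rat (lucas [:0, 1:] 2 [:0, 1:] (2 * m + 1))) (2 * cos t) = 0"
    unfolding t_def by (rule root_T) simp
  hence "2 * cos t *
      poly (real_poly_of_rat ((-1) ^ m * pcompose (P_poly m) [:0, 0, -1:])) (2 * cos t) = 0"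
    by (simp only: P_poly_neg_square[symmetric] real_poly_of_rat_mult poly_mult)
       (simp add: map_poly_pCons)
  moreover have "cos t > 0"
    using assms by (intro cos_gt_zero_pi) (auto simp: t_def field_simps add_pos_pos intro: less_le_trans[of _ 0])
  ultimately show ?thesis by (simp add: t_def algebra_simps)
qed

section \<open>Irreducible numerators\<close>

lemma degree_lead_coeff_eqI:
  fixes p :: "int poly"
  assumes "coeff p n = 1" "\<And>k. k > n \<Longrightarrow> coeff p k = 0"
  shows "degree p = n \<and> lead_coeff p = 1"
proof -
  have "n \<le> degree p" by (rule le_degree) (simp add: assms(1))
  moreover have "degree p \<le> n" by (rule degree_le) (simp add: assms(2))
  ultimately have "degree p = n" by simp
  thus ?thesis using assms(1) by simp
qed

lemma degree_P_int: "degree (P_int m) = m" and lead_coeff_P_int: "lead_coeff (P_int m) = 1"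
  using degree_lead_coeff_eqI[of "P_int m" m]
  by (simp_all add: coeff_P_int binomial_eq_0 mult_2[symmetric])

lemma degree_Q_int: "m \<ge> 1 \<Longrightarrow> degree (Q_int m) = m"
  and lead_coeff_Q_int: "m \<ge> 1 \<Longrightarrow> lead_coeff (Q_int m) = 1"
  using degree_lead_coeff_eqI[of "Q_int m" m]
  by (simp_all add: coeff_Q_int binomial_eq_0 mult_2[symmetric])

lemma prime_dvd_coeff_P_int:
  assumes "prime (2 * m + 1)" "k < m"
  shows "int (2 * m + 1) dvd coeff (P_int m) k"
proof -
  have "int (2 * m + 1) dvd int (2 * k + 1) * coeff (P_int m) k"
    unfolding coeff_P_int_mult by simp
  moreover have "\<not> int (2 * m + 1) dvd int (2 * k + 1)"
    using assms(2) by (auto dest!: zdvd_imp_le)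
  moreover have "prime (int (2 * m + 1))" using assms(1) by (simp only: prime_int_nat_transfer nat_int) simp
  ultimately show ?thesis using prime_dvd_mult_iff by blast
qed

lemma coeff_0_P_int: "coeff (P_int m) 0 = int (2 * m + 1)"
  by (simp add: coeff_P_int)

lemma not_square_dvd_self: "prime p \<Longrightarrow> \<not> p ^ 2 dvd (p :: int)"
  by (auto simp: power2_eq_square dest: prime_gt_1_int)

lemma irreducible_P_poly:
  assumes "prime (2 * m + 1)" "m \<ge> 1"
  shows "irreducible (P_poly m)"
  unfolding P_poly_eq_int
proof (rule eisenstein)
  show p: "prime (int (2 * m + 1))" using assms(1) by (simp only: prime_int_nat_transfer nat_int) simp
  show "lead_coeff (P_int m) = 1" by (rule lead_coeff_P_int)
  show "\<not> int (2 * m + 1) ^ 2 dvd coeff (P_int m) 0"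
    unfolding coeff_0_P_int by (rule not_square_dvd_self[OF p])
qed (use assms prime_dvd_coeff_P_int in \<open>simp_all only: degree_P_int\<close>)

text \<open>Eisenstein at \<open>2\<close>: an odd coefficient of index \<open>k\<close> would make the power of two \<open>m\<close> divide \<open>k\<close>,
  which is impossible for \<open>0 < k < m\<close>.\<close>

lemma irreducible_Q_poly:
  assumes "m = 2 ^ j"
  shows "irreducible (Q_poly m)"
proof -
  have m: "m \<ge> 1" using assms by simp
  show ?thesis unfolding Q_poly_eq_int[OF m]
  proof (rule eisenstein)
    show "prime (2::int)" by simp
    show "lead_coeff (Q_int m) = 1" by (rule lead_coeff_Q_int[OF m])
    show "\<not> 2\<^sup>2 dvd coeff (Q_int m) 0" by (simp add: coeff_Q_int)
    fix k assume "k < degree (Q_int m)"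
    hence k: "k < m" using m by (simp add: degree_Q_int)
    show "2 dvd coeff (Q_int m) k"
    proof (rule ccontr)
      assume odd: "\<not> 2 dvd coeff (Q_int m) k"
      hence "k \<noteq> 0" by (auto simp: coeff_Q_int intro!: Nat.gr0I)
      hence "int m dvd int k * coeff (Q_int m) k"
        using m by (subst coeff_Q_int_mult) auto
      moreover have "coprime (int m) (coeff (Q_int m) k)"
        using odd by (simp add: assms)
      ultimately have "int m dvd int k" by (simp add: coprime_dvd_mult_left_iff)
      thus False using k \<open>k \<noteq> 0\<close> by (auto dest: dvd_imp_le)
    qed
  qed (use m in \<open>simp add: degree_Q_int\<close>)
qed

lemma minus_one_power_mult: "(-1) ^ m * p = smult ((-1) ^ m) (p :: 'a::comm_ring_1 poly)"
  by (cases "even m") simp_all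

lemma rat_poly_of_int_pcompose:
  "rat_poly_of_int (pcompose p q) = pcompose (rat_poly_of_int p) (rat_poly_of_int q)"
  by (rule map_poly_hom_pcompose) auto

lemma P_neg_square_eq_int:
  "(-1) ^ m * pcompose (P_poly m) [:0, 0, -1:] =
     rat_poly_of_int (smult ((-1) ^ m) (pcompose (P_int m) [:0, 0, -1:]))"
  by (simp add: minus_one_power_mult rat_poly_of_int_smult rat_poly_of_int_pcompose P_poly_eq_int
      map_poly_pCons)

lemma lead_coeff_reflected_pcompose:
  fixes p q :: "int poly"
  assumes "lead_coeff p = 1" "degree q > 0" "lead_coeff q = -1"
  shows "lead_coeff (smult ((-1) ^ degree p) (pcompose p q)) = 1"
  using assms(2) by (simp only: lead_coeff_smult lead_coeff_comp assms)
    (simp flip: power_mult_distrib)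

lemma lead_coeff_P_neg_square:
  "lead_coeff (smult ((-1) ^ m) (pcompose (P_int m) [:0, 0, -1:])) = 1"
  using lead_coeff_reflected_pcompose[OF lead_coeff_P_int[of m], of "[:0, 0, -1:]"]
  by (simp only: degree_P_int) simp

text \<open>Substituting \<open>-x\<^sup>2\<close> preserves the hypotheses of Eisenstein's criterion but not irreducibility in
  general, so the criterion is applied afresh.  Modulo \<open>p\<close> the polynomial \<open>P\<^sub>m\<close> is \<open>x\<^sup>m\<close>, and this
  congruence survives the substitution.\<close>

lemma irreducible_P_poly_neg_square:
  assumes "prime (2 * m + 1)" "m \<ge> 1"
  shows "irreducible ((-1) ^ m * pcompose (P_poly m) [:0, 0, -1:])"
  unfolding P_neg_square_eq_int
proof (rule eisenstein)
  let ?p = "int (2 * m + 1)" and ?q = "[:0, 0, -1:] :: int poly"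
  let ?F = "smult ((-1) ^ m) (pcompose (P_int m) ?q)"
  show p: "prime ?p" using assms(1) by (simp only: prime_int_nat_transfer nat_int) simp
  show "lead_coeff ?F = 1" by (rule lead_coeff_P_neg_square)
  have deg: "degree ?F = 2 * m" by (simp add: degree_pcompose degree_P_int)
  thus "degree ?F > 0" using assms(2) by simp
  have "coeff ?F 0 = (-1) ^ m * ?p" by (simp add: poly_0_coeff_0 coeff_0_P_int)
  thus "\<not> ?p ^ 2 dvd coeff ?F 0"
    using not_square_dvd_self[OF p]
    by (cases "even m") (simp_all only: neg_one_even_power neg_one_odd_power mult_1_left
        mult_minus1 dvd_minus_iff not_False_eq_True)
  fix k assume "k < degree ?F"
  hence k: "k < 2 * m" using deg by simp
  have "[:?p:] dvd P_int m - monom 1 m"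
    unfolding const_poly_dvd_iff
  proof
    fix i
    consider "i < m" | "i = m" | "i > m" by linarith
    thus "?p dvd coeff (P_int m - monom 1 m) i"
    proof cases
      case 1
      thus ?thesis using prime_dvd_coeff_P_int[OF assms(1) 1] by simp
    next
      case 2
      thus ?thesis using lead_coeff_P_int[of m] by (simp add: degree_P_int)
    next
      case 3
      thus ?thesis by (simp add: coeff_eq_0 degree_P_int)
    qed
  qed
  then obtain H where "P_int m - monom 1 m = [:?p:] * H" by (elim dvdE)
  hence "P_int m = monom 1 m + [:?p:] * H" by (simp add: algebra_simps)
  hence "pcompose (P_int m) ?q = pcompose (monom 1 m) ?q + [:?p:] * pcompose H ?q"
    by (simp only: pcompose_add pcompose_mult pcompose_const)
  moreover have "pcompose (monom 1 m) ?q = monom ((-1) ^ m) (2 * m)"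
  proof -
    have q: "?q = monom (-1) 2" by (simp add: monom_Suc eval_nat_numeral monom_0)
    have "pcompose (monom 1 m) ?q = ?q ^ m"
      by (induction m) (simp_all add: monom_0 monom_Suc pcompose_pCons one_pCons)
    thus ?thesis by (simp only: q monom_power)
  qed
  ultimately have "coeff ?F k = (-1) ^ m * (?p * coeff (pcompose H ?q) k)"
    using k by simp
  thus "?p dvd coeff ?F k" by (simp only: dvd_mult dvd_triv_left)
qed

section \<open>The five quotients\<close>

lemma quotient_P_shift:
  assumes "m \<ge> 1"
  defines "R \<equiv> Fract (pcompose (P_poly m) [:-2, 1:]) (Theta_poly (2 * m + 1))"
  shows "prime (2 * m + 1) \<Longrightarrow> R = 1" "R \<in> int_polys"
proof -
  let ?F = "pcompose (P_int m) [:-2, 1:]"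
  have F: "pcompose (P_poly m) [:-2, 1:] = rat_poly_of_int ?F"
    by (simp add: rat_poly_of_int_pcompose P_poly_eq_int map_poly_pCons)
  have lc: "lead_coeff ?F = 1" by (subst lead_coeff_comp) (simp_all add: lead_coeff_P_int)
  have root: "poly (real_poly_of_rat (rat_poly_of_int ?F)) (2 * cos (2 * pi / real (2 * m + 1))) = 0"
    unfolding F[symmetric] P_poly_shift by (rule root_W[OF assms(1)])
  show "R \<in> int_polys"
    unfolding R_def F Theta_poly_def by (rule Fract_min_poly_in_int_polys[OF lc root])
  assume "prime (2 * m + 1)"
  hence "irreducible (rat_poly_of_int ?F)"
    unfolding F[symmetric] using irreducible_P_poly assms(1) by (intro irreducible_pcompose_linear) auto
  thus "R = 1" unfolding R_def F Theta_poly_def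
    using lc root by (intro Fract_self_min_poly) (simp_all only: lead_coeff_rat_poly_of_int of_int_1)
qed

lemma quotient_Q_shift:
  assumes "m \<ge> 1"
  defines "R \<equiv> Fract (pcompose (Q_poly m) [:-2, 1:]) (C_poly (2 * m))"
  shows "\<exists>k. m = 2 ^ k \<Longrightarrow> R = 1" "R \<in> int_polys"
proof -
  let ?F = "pcompose (Q_int m) [:-2, 1:]"
  have F: "pcompose (Q_poly m) [:-2, 1:] = rat_poly_of_int ?F"
    using assms(1) by (simp add: rat_poly_of_int_pcompose Q_poly_eq_int map_poly_pCons)
  have lc: "lead_coeff ?F = 1" using assms(1) by (subst lead_coeff_comp) (simp_all add: lead_coeff_Q_int)
  have root: "poly (real_poly_of_rat (rat_poly_of_int ?F)) (2 * cos (pi / real (2 * m))) = 0"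
    unfolding F[symmetric] Q_poly_shift[OF assms(1)] by (rule root_T[OF assms(1)])
  show "R \<in> int_polys"
    unfolding R_def F C_poly_def by (rule Fract_min_poly_in_int_polys[OF lc root])
  assume "\<exists>k. m = 2 ^ k"
  hence "irreducible (rat_poly_of_int ?F)"
    unfolding F[symmetric] using irreducible_Q_poly by (intro irreducible_pcompose_linear) auto
  thus "R = 1" unfolding R_def F C_poly_def
    using lc root by (intro Fract_self_min_poly) (simp_all only: lead_coeff_rat_poly_of_int of_int_1)
qed

lemma quotient_P_neg_square:
  assumes "m \<ge> 1"
  defines "R \<equiv> Fract ((-1) ^ m * pcompose (P_poly m) [:0, 0, -1:]) (C_poly (4 * m + 2))"
  shows "prime (2 * m + 1) \<Longrightarrow> R = 1" "R \<in> int_polys"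
proof -
  note root = root_P_neg_square[OF assms(1)] and lc = lead_coeff_P_neg_square[of m]
  show "R \<in> int_polys"
    unfolding R_def C_poly_def using root unfolding P_neg_square_eq_int
    by (intro Fract_min_poly_in_int_polys[OF lc])
  assume "prime (2 * m + 1)"
  hence "irreducible ((-1) ^ m * pcompose (P_poly m) [:0, 0, -1:])"
    using irreducible_P_poly_neg_square assms(1) by blast
  thus "R = 1" unfolding R_def C_poly_def
    using lc root by (intro Fract_self_min_poly)
      (simp_all only: P_neg_square_eq_int lead_coeff_rat_poly_of_int of_int_1)
qed

lemma quotient_V:
  assumes "m \<ge> 1"
  defines "R \<equiv> Fract (V_poly m) (C_poly (2 * m + 1))"
  shows "prime (2 * m + 1) \<Longrightarrow> R = 1" "R \<in> int_polys"
proof -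
  let ?F = "smult ((-1) ^ m) (pcompose (P_int m) [:-2, -1:])"
  have F: "V_poly m = rat_poly_of_int ?F"
    unfolding P_poly_reflect[symmetric]
    by (simp add: minus_one_power_mult rat_poly_of_int_smult rat_poly_of_int_pcompose
        P_poly_eq_int map_poly_pCons)
  have lc: "lead_coeff ?F = 1"
    using lead_coeff_reflected_pcompose[OF lead_coeff_P_int[of m], of "[:-2, -1:]"]
    by (simp only: degree_P_int) simp
  have root: "poly (real_poly_of_rat (rat_poly_of_int ?F)) (2 * cos (pi / real (2 * m + 1))) = 0"
    unfolding F[symmetric] by (rule root_V[OF assms(1)])
  show "R \<in> int_polys"
    unfolding R_def F C_poly_def by (rule Fract_min_poly_in_int_polys[OF lc root])
  assume "prime (2 * m + 1)"
  hence "irreducible (pcompose (P_poly m) [:-2, -1:])"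
    using irreducible_P_poly assms(1) by (intro irreducible_pcompose_linear) auto
  hence "irreducible (rat_poly_of_int ?F)"
    unfolding F[symmetric] P_poly_reflect[symmetric]
    by (subst irreducible_mult_unit_left) (simp_all add: is_unit_power_iff)
  thus "R = 1" unfolding R_def F C_poly_def
    using lc root by (intro Fract_self_min_poly) (simp_all only: lead_coeff_rat_poly_of_int of_int_1)
qed

lemma C_poly_nonzero: "n \<ge> 1 \<Longrightarrow> C_poly n \<noteq> 0"
  using is_min_poly_C_poly[of n] by (auto simp: is_min_poly_def)

text \<open>For \<open>m = 2n+1\<close> the numerator has the rational root \<open>0\<close>; the cofactor of \<open>x\<close> is the numerator
  \<open>(-1)\<^sup>n P\<^sub>n(-x\<^sup>2)\<close> of another quotient with the same denominator.\<close>

lemma quotient_Q_shift_odd_prime: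
  assumes "prime m" "odd m"
  shows "Fract (pcompose (Q_poly m) [:-2, 1:]) (C_poly (2 * m)) = Fract [:0, 1:] 1"
proof -
  obtain n where n: "m = 2 * n + 1" using assms(2) by (elim oddE)
  have "n \<ge> 1" using assms(1) n by (cases n) auto
  define g where "g = (-1) ^ n * pcompose (P_poly n) [:0, 0, -1:]"
  have C: "C_poly (2 * m) \<noteq> 0" using n by (intro C_poly_nonzero) simp
  have "Fract g (C_poly (2 * m)) = 1"
    using quotient_P_neg_square(1)[OF \<open>n \<ge> 1\<close>] assms(1) by (simp add: g_def n)
  hence "g = C_poly (2 * m)" using C by (simp add: One_fract_def eq_fract)
  moreover have "pcompose (Q_poly m) [:-2, 1:] = [:0, 1:] * g"
    using n by (simp only: g_def P_poly_neg_square Q_poly_shift)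
  ultimately show ?thesis using C by (simp add: eq_fract)
qed

theorem theorem10:
  fixes m :: nat
  assumes "m \<ge> 1"
  shows
    "(let R = Fract (pcompose (P_poly m) [:-2, 1:]) (Theta_poly (2 * m + 1)) in
        (prime (2 * m + 1) \<longrightarrow> R = 1) \<and>
        (\<not> prime (2 * m + 1) \<longrightarrow> R \<in> int_polys)) \<and>
     (let R = Fract (pcompose (Q_poly m) [:-2, 1:]) (C_poly (2 * m)) in
        ((\<exists>k. m = 2 ^ k) \<longrightarrow> R = 1) \<and>
        (prime m \<and> odd m \<longrightarrow> R = Fract [:0, 1:] 1) \<and>
        (\<not> (\<exists>k. m = 2 ^ k) \<and> \<not> (prime m \<and> odd m) \<longrightarrow> R \<in> int_polys)) \<and>
     (let R = Fract (- pcompose (Q_poly (2 * m + 1)) [:-2, -1:]) ([:0, 1:] * C_poly (4 * m + 2));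
          R' = Fract ((-1) ^ m * pcompose (P_poly m) [:0, 0, -1:]) (C_poly (4 * m + 2)) in
        R = R' \<and>
        (prime (2 * m + 1) \<longrightarrow> R' = 1) \<and>
        (\<not> prime (2 * m + 1) \<longrightarrow> R' \<in> int_polys)) \<and>
     (let R = Fract (pcompose (Q_poly (2 * m)) [:-2, -1:]) (C_poly (4 * m));
          R' = Fract ((-1) ^ m * pcompose (Q_poly m) [:0, 0, -1:]) (C_poly (4 * m)) in
        R = R' \<and>
        ((\<exists>k. m = 2 ^ k) \<longrightarrow> R' = 1) \<and>
        (\<not> (\<exists>k. m = 2 ^ k) \<longrightarrow> R' \<in> int_polys)) \<and>
     (let R = Fract ((-1) ^ m * pcompose (P_poly m) [:-2, -1:]) (C_poly (2 * m + 1));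
          R' = Fract (V_poly m) (C_poly (2 * m + 1)) in
        R = R' \<and>
        (prime (2 * m + 1) \<longrightarrow> R' = 1) \<and>
        (\<not> prime (2 * m + 1) \<longrightarrow> R' \<in> int_polys))"
proof -
  \<comment> \<open>The fourth quotient is the second one with \<open>2m\<close> in place of \<open>m\<close>.\<close>
  have Q2: "pcompose (Q_poly (2 * m)) [:-2, -1:] = pcompose (Q_poly (2 * m)) [:-2, 1:]"
    using Q_poly_reflect[of "2 * m"] assms by (simp add: Q_poly_shift)
  have Q2': "(-1) ^ m * pcompose (Q_poly m) [:0, 0, -1:] = pcompose (Q_poly (2 * m)) [:-2, 1:]"
    using assms by (simp add: Q_poly_shift Q_poly_neg_square)
  have Q1: "- pcompose (Q_poly (2 * m + 1)) [:-2, -1:] =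
      [:0, 1:] * ((-1) ^ m * pcompose (P_poly m) [:0, 0, -1:])"
    using Q_poly_reflect[of "2 * m + 1"] by (simp only: P_poly_neg_square) simp
  have "Fract ([:0, 1:] * ((-1) ^ m * pcompose (P_poly m) [:0, 0, -1:])) ([:0, 1:] * C_poly (4 * m + 2)) =
      Fract ((-1) ^ m * pcompose (P_poly m) [:0, 0, -1:]) (C_poly (4 * m + 2))"
    by (rule mult_fract_cancel) simp
  moreover have "\<exists>k. 2 * m = 2 ^ k" if "\<exists>k. m = 2 ^ k"
    using that by (metis power_Suc)
  ultimately show ?thesis
    unfolding Let_def Q1 Q2 Q2' P_poly_reflect
    using quotient_P_shift[OF assms] quotient_Q_shift[OF assms] quotient_Q_shift_odd_prime[of m]
      quotient_P_neg_square[OF assms] quotient_Q_shift[of "2 * m"] quotient_V[OF assms] assms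
    by (simp only: mult.assoc[symmetric]) auto
qed

end
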